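(* Let $(M,\omega)$ be a closed symplectic manifold and $\mathbb{A}$ a finite-dimensional Poisson-commutative subspace of $C^{\infty}(M)$, with moment map $\Phi\colon M\to\mathbb{A}^{\ast}$. Let $\zeta\colon C(M)\to\mathbb{R}$ be a simple partial symplectic quasi-state on $(M,\omega)$. Then there exists $y_0\in\Phi(M)$ such that $\Phi^{-1}(y_0)$ is $\zeta$-heavy.
   Context: $C(M)$ (resp. $C^\infty(M)$) is the set of continuous (resp. smooth) real-valued functions on $M$. A subspace $\mathbb{A}\subset C^\infty(M)$ is Poisson-commutative if $\{F,G\}=0$ for all $F,G\in\mathbb{A}$; its moment map $\Phi\colon M\to\mathbb{A}^\ast$ is given by $F(x)=\langle\Phi(x),F\rangle$ for $x\in M$, $F\in\mathbb{A}$. For a (smooth) Hamiltonian $H\colon S^1\times M\to\mathbb{R}$ ($S^1=\mathbb{R}/\mathbb{Z}$, $H_t=H(t,\cdot)$), the Hamiltonian vector field is defined by $\iota_{X_{H_t}}\omega=-dH_t$, and $\varphi_H$ is the time-1 map of its flow; $\mathrm{Ham}(M,\omega)$ is the group of all such $\varphi_H$. A subset $X\subset M$ is displaceable from $Y\subset M$ if there is $H$ with $\varphi_H(X)\cap\overline{Y}=\emptyset$. A partial symplectic quasi-state on $(M,\omega)$ is a functional $\zeta\colon C(M)\to\mathbb{R}$ such that: (Normalization) $\zeta(a)=a$ for every constant function $a$; (Stability) $\min_M(H_1-H_2)\le\zeta(H_1)-\zeta(H_2)\le\max_M(H_1-H_2)$ for all $H_1,H_2\in C(M)$; (Semi-homogeneity)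 $\zeta(sH)=s\zeta(H)$ for all $H\in C(M)$, $s>0$; (Hamiltonian invariance) $\zeta(H\circ\phi)=\zeta(H)$ for all $H\in C(M)$, $\phi\in\mathrm{Ham}(M,\omega)$; (Vanishing) $\zeta(H)=0$ for every $H\in C(M)$ whose support is displaceable from itself; (Quasi-subadditivity) $\zeta(H_1+H_2)\le\zeta(H_1)+\zeta(H_2)$ for all $H_1,H_2\in C^\infty(M)$ with $\{H_1,H_2\}=0$. A closed subset $X\subset M$ is $\zeta$-heavy if $\zeta(H)\ge\inf_X H$ for every $H\in C(M)$. For a closed subset $X\subset M$, $\tau_\zeta(X)=\inf\{\zeta(a)\mid a\colon M\to[0,1]\text{ continuous},\ a|_X\equiv 1\}$. The partial symplectic quasi-state $\zeta$ is simple if $\tau_\zeta(X)\in\{0,1\}$ for every closed subset $X\subset M$. *)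

theory Defs
  imports "HOL-Analysis.Analysis" "HOL-Library.Function_Algebras"
begin

section \<open>Smooth maps between normed spaces\<close>

text \<open>Used only for open \<open>S\<close> in a finite-dimensional domain, where this is the usual notion of \<open>C\<^sup>k\<close>.\<close>

primrec Ck_on :: "nat \<Rightarrow> 'a::real_normed_vector set \<Rightarrow> ('a \<Rightarrow> 'b::real_normed_vector) \<Rightarrow> bool" where
  "Ck_on 0 S f \<longleftrightarrow> continuous_on S f"
| "Ck_on (Suc k) S f \<longleftrightarrow>
     (\<forall>x\<in>S. f differentiable (at x)) \<and> (\<forall>v. Ck_on k S (\<lambda>x. frechet_derivative f (at x) v))"

definition smooth_on :: "'a::real_normed_vector set \<Rightarrow> ('a \<Rightarrow> 'b::real_normed_vector) \<Rightarrow> bool" where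
  "smooth_on S f \<longleftrightarrow> (\<forall>k. Ck_on k S f)"

section \<open>Closed smooth manifolds\<close>

text \<open>
  The manifold \<open>M\<close> is the whole topological space \<open>'a\<close>. A chart is a pair \<open>(U, \<kappa>)\<close> of an open
  domain and a coordinate map; only the values of \<open>\<kappa>\<close> on \<open>U\<close> matter, and \<open>inv_into U \<kappa>\<close> is the
  local parametrisation. The model space \<open>'b\<close> is a finite-dimensional normed space, not a
  \<open>euclidean_space\<close>, because that class excludes dimension 0.
\<close>

type_synonym ('a, 'b) chart = "'a set \<times> ('a \<Rightarrow> 'b)"

definition is_chart :: "('a::topological_space, 'b::real_normed_vector) chart \<Rightarrow> bool" where
  "is_chart c \<longleftrightarrow> (case c of (U, \<kappa>) \<Rightarrow>
     open U \<and> open (\<kappa> ` U) \<and> homeomorphism U (\<kappa> ` U) \<kappa> (inv_into U \<kappa>))"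

definition smooth_atlas :: "('a::topological_space, 'b::real_normed_vector) chart set \<Rightarrow> bool" where
  "smooth_atlas \<A> \<longleftrightarrow>
     (\<forall>c\<in>\<A>. is_chart c) \<and>
     (\<Union>(U, \<kappa>)\<in>\<A>. U) = UNIV \<and>
     (\<forall>(U, \<kappa>)\<in>\<A>. \<forall>(V, \<mu>)\<in>\<A>. smooth_on (\<kappa> ` (U \<inter> V)) (\<mu> \<circ> inv_into U \<kappa>))"

text \<open>Second countability is implied by compactness.\<close>

definition closed_manifold :: "('a::t2_space, 'b::real_normed_vector) chart set \<Rightarrow> bool" where
  "closed_manifold \<A> \<longleftrightarrow>
     (\<exists>B::'b set. finite B \<and> span B = UNIV) \<and> compact (UNIV :: 'a set) \<and> smooth_atlas \<A>"

definition C_infinity ::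
    "('a::topological_space, 'b::real_normed_vector) chart set \<Rightarrow> ('a \<Rightarrow> real) set" where
  "C_infinity \<A> = {F. \<forall>(U, \<kappa>)\<in>\<A>. smooth_on (\<kappa> ` U) (F \<circ> inv_into U \<kappa>)}"

text \<open>
  Tangent vectors at \<open>p\<close> are realised as derivations on smooth functions, namely as the
  directional derivatives at \<open>p\<close> taken in charts. They are set to 0 outside \<open>C_infinity \<A>\<close>, so
  that equal tangent vectors are equal functions. In particular \<open>dF(v)\<close> is \<open>v F\<close>.
\<close>

type_synonym 'a tvec = "('a \<Rightarrow> real) \<Rightarrow> real"

definition coord_vec ::
    "('a::topological_space, 'b::real_normed_vector) chart set \<Rightarrow> ('a, 'b) chart \<Rightarrow> 'a \<Rightarrow> 'b \<Rightarrow> 'a tvec" where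
  "coord_vec \<A> c p u = (case c of (U, \<kappa>) \<Rightarrow>
     (\<lambda>F. if F \<in> C_infinity \<A> then frechet_derivative (F \<circ> inv_into U \<kappa>) (at (\<kappa> p)) u else 0))"

definition tangent_space ::
    "('a::topological_space, 'b::real_normed_vector) chart set \<Rightarrow> 'a \<Rightarrow> 'a tvec set" where
  "tangent_space \<A> p = {coord_vec \<A> c p u | c u. c \<in> \<A> \<and> p \<in> fst c}"

section \<open>Symplectic forms\<close>

text \<open>The coefficients of \<open>\<omega>\<close> in a chart, at the point with coordinates \<open>x\<close>.\<close>

definition form_in_chart ::
    "('a::topological_space, 'b::real_normed_vector) chart set \<Rightarrow> ('a \<Rightarrow> 'a tvec \<Rightarrow> 'a tvec \<Rightarrow> real) \<Rightarrow>
     ('a, 'b) chart \<Rightarrow> 'b \<Rightarrow> 'b \<Rightarrow> 'b \<Rightarrow> real" where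
  "form_in_chart \<A> \<omega> c x u v = (case c of (U, \<kappa>) \<Rightarrow>
     (let p = inv_into U \<kappa> x in \<omega> p (coord_vec \<A> c p u) (coord_vec \<A> c p v)))"

definition smooth_2form ::
    "('a::topological_space, 'b::real_normed_vector) chart set \<Rightarrow> ('a \<Rightarrow> 'a tvec \<Rightarrow> 'a tvec \<Rightarrow> real) \<Rightarrow> bool" where
  "smooth_2form \<A> \<omega> \<longleftrightarrow>
     (\<forall>p. \<forall>v\<in>tangent_space \<A> p. \<omega> p v v = 0) \<and>
     (\<forall>c\<in>\<A>. (\<forall>x\<in>snd c ` fst c. bilinear (form_in_chart \<A> \<omega> c x)) \<and>
             (\<forall>u v. smooth_on (snd c ` fst c) (\<lambda>x. form_in_chart \<A> \<omega> c x u v)))"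

text \<open>\<open>d\<omega> = 0\<close>, evaluated on the (commuting) constant coordinate fields \<open>u, v, w\<close> of each chart.\<close>

definition closed_2form ::
    "('a::topological_space, 'b::real_normed_vector) chart set \<Rightarrow> ('a \<Rightarrow> 'a tvec \<Rightarrow> 'a tvec \<Rightarrow> real) \<Rightarrow> bool" where
  "closed_2form \<A> \<omega> \<longleftrightarrow>
     (\<forall>c\<in>\<A>. \<forall>x\<in>snd c ` fst c. \<forall>u v w.
        frechet_derivative (\<lambda>z. form_in_chart \<A> \<omega> c z v w) (at x) u
      + frechet_derivative (\<lambda>z. form_in_chart \<A> \<omega> c z w u) (at x) v
      + frechet_derivative (\<lambda>z. form_in_chart \<A> \<omega> c z u v) (at x) w = 0)"

definition nondegenerate_2form ::
    "('a::topological_space, 'b::real_normed_vector) chart set \<Rightarrow> ('a \<Rightarrow> 'a tvec \<Rightarrow> 'a tvec \<Rightarrow> real) \<Rightarrow> bool" where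
  "nondegenerate_2form \<A> \<omega> \<longleftrightarrow>
     (\<forall>p. \<forall>v\<in>tangent_space \<A> p. (\<forall>w\<in>tangent_space \<A> p. \<omega> p v w = 0) \<longrightarrow> v = (\<lambda>_. 0))"

definition closed_symplectic_manifold ::
    "('a::t2_space, 'b::real_normed_vector) chart set \<Rightarrow> ('a \<Rightarrow> 'a tvec \<Rightarrow> 'a tvec \<Rightarrow> real) \<Rightarrow> bool" where
  "closed_symplectic_manifold \<A> \<omega> \<longleftrightarrow>
     closed_manifold \<A> \<and> smooth_2form \<A> \<omega> \<and> closed_2form \<A> \<omega> \<and> nondegenerate_2form \<A> \<omega>"

section \<open>Hamiltonian dynamics\<close>

definition ham_vec ::
    "('a::topological_space, 'b::real_normed_vector) chart set \<Rightarrow> ('a \<Rightarrow> 'a tvec \<Rightarrow> 'a tvec \<Rightarrow> real) \<Rightarrow>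
     ('a \<Rightarrow> real) \<Rightarrow> 'a \<Rightarrow> 'a tvec" where
  "ham_vec \<A> \<omega> F p =
     (THE v. v \<in> tangent_space \<A> p \<and> (\<forall>w\<in>tangent_space \<A> p. \<omega> p v w = - w F))"

text \<open>The opposite sign convention is also common; only vanishing of the bracket is used below.\<close>

definition poisson_bracket ::
    "('a::topological_space, 'b::real_normed_vector) chart set \<Rightarrow> ('a \<Rightarrow> 'a tvec \<Rightarrow> 'a tvec \<Rightarrow> real) \<Rightarrow>
     ('a \<Rightarrow> real) \<Rightarrow> ('a \<Rightarrow> real) \<Rightarrow> 'a \<Rightarrow> real" where
  "poisson_bracket \<A> \<omega> F G p = \<omega> p (ham_vec \<A> \<omega> F p) (ham_vec \<A> \<omega> G p)"

text \<open>Smooth functions on \<open>(\<real>/\<int>) \<times> M\<close> are 1-periodic smooth functions on \<open>\<real> \<times> M\<close>.\<close>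

definition hamiltonian ::
    "('a::topological_space, 'b::real_normed_vector) chart set \<Rightarrow> (real \<Rightarrow> 'a \<Rightarrow> real) \<Rightarrow> bool" where
  "hamiltonian \<A> H \<longleftrightarrow>
     (\<forall>t. H (t + 1) = H t) \<and>
     (\<forall>(U, \<kappa>)\<in>\<A>. smooth_on (UNIV \<times> \<kappa> ` U) (\<lambda>(t, x). H t (inv_into U \<kappa> x)))"

text \<open>
  The ODE \<open>d/dt \<phi>\<^sub>t(x) = X\<^bsub>H\<^sub>t\<^esub>(\<phi>\<^sub>t(x))\<close> is tested against all smooth functions. On a compact
  manifold this forces the curves to be smooth and to satisfy the ODE in charts.
\<close>

definition ham_flow ::
    "('a::topological_space, 'b::real_normed_vector) chart set \<Rightarrow> ('a \<Rightarrow> 'a tvec \<Rightarrow> 'a tvec \<Rightarrow> real) \<Rightarrow>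
     (real \<Rightarrow> 'a \<Rightarrow> real) \<Rightarrow> (real \<Rightarrow> 'a \<Rightarrow> 'a) \<Rightarrow> bool" where
  "ham_flow \<A> \<omega> H \<phi> \<longleftrightarrow>
     (\<forall>x. \<phi> 0 x = x \<and>
        (\<forall>t. \<forall>F\<in>C_infinity \<A>.
           ((\<lambda>s. F (\<phi> s x)) has_real_derivative ham_vec \<A> \<omega> (H t) (\<phi> t x) F) (at t)))"

definition Ham ::
    "('a::topological_space, 'b::real_normed_vector) chart set \<Rightarrow> ('a \<Rightarrow> 'a tvec \<Rightarrow> 'a tvec \<Rightarrow> real) \<Rightarrow>
     ('a \<Rightarrow> 'a) set" where
  "Ham \<A> \<omega> = {\<phi> 1 | \<phi> H. hamiltonian \<A> H \<and> ham_flow \<A> \<omega> H \<phi>}"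

definition displaceable_from ::
    "('a::topological_space, 'b::real_normed_vector) chart set \<Rightarrow> ('a \<Rightarrow> 'a tvec \<Rightarrow> 'a tvec \<Rightarrow> real) \<Rightarrow>
     'a set \<Rightarrow> 'a set \<Rightarrow> bool" where
  "displaceable_from \<A> \<omega> X Y \<longleftrightarrow> (\<exists>\<phi>\<in>Ham \<A> \<omega>. \<phi> ` X \<inter> closure Y = {})"

section \<open>Partial symplectic quasi-states\<close>

definition C_functions :: "('a::topological_space \<Rightarrow> real) set" where
  "C_functions = {H. continuous_on UNIV H}"

text \<open>
  Only the values of \<open>\<zeta>\<close> on \<open>C_functions\<close> are relevant. The infimum and supremum in the
  stability axiom are a minimum and a maximum, as \<open>M\<close> is compact and nonempty.
\<close>

definition partial_symplectic_quasi_state ::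
    "('a::topological_space, 'b::real_normed_vector) chart set \<Rightarrow> ('a \<Rightarrow> 'a tvec \<Rightarrow> 'a tvec \<Rightarrow> real) \<Rightarrow>
     (('a \<Rightarrow> real) \<Rightarrow> real) \<Rightarrow> bool" where
  "partial_symplectic_quasi_state \<A> \<omega> \<zeta> \<longleftrightarrow>
     (\<forall>a. \<zeta> (\<lambda>_. a) = a) \<and>
     (\<forall>H1\<in>C_functions. \<forall>H2\<in>C_functions.
        (INF x. H1 x - H2 x) \<le> \<zeta> H1 - \<zeta> H2 \<and> \<zeta> H1 - \<zeta> H2 \<le> (SUP x. H1 x - H2 x)) \<and>
     (\<forall>H\<in>C_functions. \<forall>s>0. \<zeta> (\<lambda>x. s * H x) = s * \<zeta> H) \<and>
     (\<forall>H\<in>C_functions. \<forall>\<phi>\<in>Ham \<A> \<omega>. \<zeta> (H \<circ> \<phi>) = \<zeta> H) \<and>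
     (\<forall>H\<in>C_functions.
        displaceable_from \<A> \<omega> (closure {x. H x \<noteq> 0}) (closure {x. H x \<noteq> 0}) \<longrightarrow> \<zeta> H = 0) \<and>
     (\<forall>H1\<in>C_infinity \<A>. \<forall>H2\<in>C_infinity \<A>.
        (\<forall>p. poisson_bracket \<A> \<omega> H1 H2 p = 0) \<longrightarrow> \<zeta> (\<lambda>x. H1 x + H2 x) \<le> \<zeta> H1 + \<zeta> H2)"

text \<open>The infimum is taken in \<open>ereal\<close>, so that \<open>inf\<^bsub>\<emptyset>\<^esub> H = \<infinity>\<close> and the empty set is not heavy.\<close>

definition heavy :: "(('a::topological_space \<Rightarrow> real) \<Rightarrow> real) \<Rightarrow> 'a set \<Rightarrow> bool" where
  "heavy \<zeta> X \<longleftrightarrow> closed X \<and> (\<forall>H\<in>C_functions. ereal (\<zeta> H) \<ge> (INF x\<in>X. ereal (H x)))"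

definition tau :: "(('a::topological_space \<Rightarrow> real) \<Rightarrow> real) \<Rightarrow> 'a set \<Rightarrow> real" where
  "tau \<zeta> X = Inf {\<zeta> a | a. a \<in> C_functions \<and> range a \<subseteq> {0..1} \<and> (\<forall>x\<in>X. a x = 1)}"

definition simple :: "(('a::topological_space \<Rightarrow> real) \<Rightarrow> real) \<Rightarrow> bool" where
  "simple \<zeta> \<longleftrightarrow> (\<forall>X. closed X \<longrightarrow> tau \<zeta> X \<in> {0, 1})"

section \<open>Moment maps\<close>

interpretation fun_space: vector_space "\<lambda>(r::real) (F::'a \<Rightarrow> real) x. r * F x"
  by unfold_locales (auto simp: algebra_simps)

definition poisson_commutative_subspace ::
    "('a::topological_space, 'b::real_normed_vector) chart set \<Rightarrow> ('a \<Rightarrow> 'a tvec \<Rightarrow> 'a tvec \<Rightarrow> real) \<Rightarrow>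
     ('a \<Rightarrow> real) set \<Rightarrow> bool" where
  "poisson_commutative_subspace \<A> \<omega> AA \<longleftrightarrow>
     AA \<subseteq> C_infinity \<A> \<and> fun_space.subspace AA \<and>
     (\<forall>F\<in>AA. \<forall>G\<in>AA. \<forall>p. poisson_bracket \<A> \<omega> F G p = 0)"

definition finite_dim_space :: "('a \<Rightarrow> real) set \<Rightarrow> bool" where
  "finite_dim_space AA \<longleftrightarrow> (\<exists>B. finite B \<and> fun_space.span B = AA)"

text \<open>
  Elements of the dual of \<open>AA\<close> are functionals restricted to \<open>AA\<close> (\<open>undefined\<close> elsewhere), so that
  equality in the dual is equality of functions.
\<close>

definition dual_space :: "('a \<Rightarrow> real) set \<Rightarrow> (('a \<Rightarrow> real) \<Rightarrow> real) set" where
  "dual_space AA = {\<xi> \<in> extensional AA.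
     (\<forall>F\<in>AA. \<forall>G\<in>AA. \<xi> (F + G) = \<xi> F + \<xi> G) \<and> (\<forall>F\<in>AA. \<forall>r. \<xi> (\<lambda>x. r * F x) = r * \<xi> F)}"

definition moment_map :: "('a \<Rightarrow> real) set \<Rightarrow> 'a \<Rightarrow> (('a \<Rightarrow> real) \<Rightarrow> real)" where
  "moment_map AA x = (\<lambda>F\<in>AA. F x)"

lemma moment_map_in_dual_space:
  assumes "fun_space.subspace AA"
  shows "moment_map AA x \<in> dual_space AA"
  using fun_space.subspace_add[OF assms] fun_space.subspace_scale[OF assms]
  by (auto simp: moment_map_def dual_space_def)

end

theory Submission
  imports Defs
begin

text \<open>
  For a nonempty closed set \<open>X\<close>, heaviness follows from \<open>\<tau>(X) = 1\<close>: a test function for heaviness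
  becomes, after truncation and an affine change, a function with values in \<open>[0,1]\<close> that equals 1 on
  \<open>X\<close>, and \<open>\<zeta>\<close> is compatible with such changes (\<open>heavy_if_tau_1\<close>). As \<open>\<zeta>\<close> is simple, it is
  therefore enough to exclude that \<open>\<tau>\<close> vanishes on every fibre of the moment map.

  Suppose that it does. By compactness of \<open>M\<close> and simplicity, \<open>\<tau>\<close> vanishes even on a closed
  neighbourhood of each fibre (\<open>simple_tau_nbhd\<close>). The classical argument would now take a smooth
  partition of unity \<open>\<rho>\<^sub>i\<close> on the image of \<open>\<Phi>\<close>, subordinate to the resulting cover: every
  \<open>\<zeta>(\<rho>\<^sub>i \<circ> \<Phi>)\<close> vanishes, whereas their sum is at least \<open>\<zeta>(1) = 1\<close> by quasi-subadditivity.
  The partition of unity is replaced here by elements of an algebra, as in the proof of the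
  Stone-Weierstrass theorem. A quadratic expression in a basis of \<open>AA\<close> gives a function \<open>u\<close> that
  is equal to 1 exactly on one fibre and smaller elsewhere (\<open>peak_function\<close>). A multiple of a high
  power of \<open>u\<close> is at least 1 near the fibre and uniformly small off the closed neighbourhood. It
  may be huge in between, but \<open>\<zeta>\<close> does not see its values on a set with \<open>\<tau> = 0\<close>
  (\<open>quasi_state_le_of_tau_0\<close>), so \<open>\<zeta>\<close> of it is as small as desired (\<open>sharpened_peak\<close>). The
  finitely many functions so obtained have sum at least 1, which contradicts subadditivity
  (\<open>exists_fibre_tau_nonzero\<close>).

  Subadditivity applies only if all functions involved, which are polynomials in elements of \<open>AA\<close>,
  Poisson-commute. They all lie in the second centralizer of \<open>AA\<close> with respect to the bracket,
  which is a commutative algebra (\<open>poisson_commutative_in_commutative_algebra\<close>). What is needed for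
  this is that the bracket is a derivation in each argument. That rests on the existence of the
  Hamiltonian vector field (\<open>ham_vec_exists1\<close>), which expresses \<open>{F, G}\<close>, up to sign, as a
  tangent vector applied to \<open>F\<close>.
\<close>

section \<open>Smooth functions form an algebra\<close>

lemma Ck_on_cong:
  assumes "open S" "\<And>x. x \<in> S \<Longrightarrow> f x = g x" "Ck_on k S f"
  shows "Ck_on k S g"
  using assms(2,3)
proof (induction k arbitrary: f g)
  case 0
  then show ?case using continuous_on_cong by auto
next
  case (Suc k)
  have ev: "eventually (\<lambda>y. f y = g y) (nhds x)" if "x \<in> S" for x
    using Suc.prems(1) assms(1) that eventually_nhds by blast
  have d: "(g has_derivative frechet_derivative f (at x)) (at x)" if "x \<in> S" for x
    using Suc.prems(2) that frechet_derivative_works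
    by (auto intro!: has_derivative_transform_within_open[OF _ assms(1) that Suc.prems(1)])
  then have e: "frechet_derivative f (at x) = frechet_derivative g (at x)" if "x \<in> S" for x
    using that frechet_derivative_at by blast
  show ?case
    using Suc.prems(2) d e Suc.IH[of "\<lambda>x. frechet_derivative f (at x) v" "\<lambda>x. frechet_derivative g (at x) v" for v]
    by (auto simp: differentiable_def)
qed

lemma Ck_on_const: "Ck_on k S (\<lambda>_. c)"
  by (induction k arbitrary: c) auto

lemma Ck_on_Suc_continuous:
  assumes "Ck_on (Suc k) S f" shows "continuous_on S f"
  using assms
  by (simp add: differentiable_imp_continuous_on differentiable_on_def differentiable_at_withinI)

lemma Ck_on_Suc_imp: "Ck_on (Suc k) S f \<Longrightarrow> Ck_on k S f"
proof (induction k arbitrary: f)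
  case 0
  then show ?case using Ck_on_Suc_continuous by (metis Ck_on.simps(1))
next
  case (Suc k)
  then show ?case by (metis Ck_on.simps(2))
qed

lemma frechet_derivative_add:
  assumes "f differentiable (at x)" "g differentiable (at x)"
  shows "frechet_derivative (\<lambda>x. f x + g x) (at x) v
       = frechet_derivative f (at x) v + frechet_derivative g (at x) v"
  by (rule fun_cong[OF frechet_derivative_at[OF has_derivative_add[OF assms[unfolded frechet_derivative_works]]],
        symmetric])

lemma Ck_on_add:
  fixes f g :: "'a::real_normed_vector \<Rightarrow> 'b::real_normed_vector"
  assumes "open S" "Ck_on k S f" "Ck_on k S g"
  shows "Ck_on k S (\<lambda>x. f x + g x)"
  using assms(2,3)
proof (induction k arbitrary: f g)
  case 0
  then show ?case by (auto intro: continuous_intros)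
next
  case (Suc k)
  have "Ck_on k S (\<lambda>x. frechet_derivative (\<lambda>x. f x + g x) (at x) v)" for v
  proof (rule Ck_on_cong[OF assms(1)])
    show "Ck_on k S (\<lambda>x. frechet_derivative f (at x) v + frechet_derivative g (at x) v)"
      using Suc by auto
    show "frechet_derivative f (at x) v + frechet_derivative g (at x) v
        = frechet_derivative (\<lambda>x. f x + g x) (at x) v" if "x \<in> S" for x
      using Suc.prems that by (simp add: frechet_derivative_add)
  qed
  then show ?case using Suc.prems by (auto intro: differentiable_add)
qed

lemma frechet_derivative_mult_real:
  fixes f g :: "'a::real_normed_vector \<Rightarrow> real"
  assumes "f differentiable (at x)" "g differentiable (at x)"
  shows "frechet_derivative (\<lambda>x. f x * g x) (at x) v
       = f x * frechet_derivative g (at x) v + frechet_derivative f (at x) v * g x"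
  by (rule fun_cong[OF frechet_derivative_at[OF has_derivative_mult[OF assms[unfolded frechet_derivative_works]]],
        symmetric])

lemma Ck_on_mult:
  fixes f g :: "'a::real_normed_vector \<Rightarrow> real"
  assumes "open S" "Ck_on k S f" "Ck_on k S g"
  shows "Ck_on k S (\<lambda>x. f x * g x)"
  using assms(2,3)
proof (induction k arbitrary: f g)
  case 0
  then show ?case by (auto intro: continuous_intros)
next
  case (Suc k)
  have "Ck_on k S (\<lambda>x. frechet_derivative (\<lambda>x. f x * g x) (at x) v)" for v
  proof (rule Ck_on_cong[OF assms(1)])
    show "Ck_on k S (\<lambda>x. f x * frechet_derivative g (at x) v + frechet_derivative f (at x) v * g x)"
      using Suc.prems Ck_on_Suc_imp[OF Suc.prems(1)] Ck_on_Suc_imp[OF Suc.prems(2)]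
      by (intro Ck_on_add[OF assms(1)] Suc.IH) auto
    show "f x * frechet_derivative g (at x) v + frechet_derivative f (at x) v * g x
        = frechet_derivative (\<lambda>x. f x * g x) (at x) v" if "x \<in> S" for x
      using Suc.prems that by (simp add: frechet_derivative_mult_real)
  qed
  then show ?case using Suc.prems by (auto intro: differentiable_mult)
qed

lemma smooth_on_differentiable:
  assumes "smooth_on S f" "x \<in> S" shows "f differentiable (at x)"
  using assms(1)[unfolded smooth_on_def, THEN spec, of "Suc 0"] assms(2) by simp

lemma C_infinity_const: "(\<lambda>_. c) \<in> C_infinity \<A>"
  by (auto simp: C_infinity_def smooth_on_def comp_def Ck_on_const)

lemma smooth_atlas_open_image:
  assumes "smooth_atlas \<A>" "(U, \<kappa>) \<in> \<A>" shows "open (\<kappa> ` U)"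
  using assms by (auto simp: smooth_atlas_def is_chart_def)

lemma C_infinity_add:
  assumes "smooth_atlas \<A>" "F \<in> C_infinity \<A>" "G \<in> C_infinity \<A>"
  shows "(\<lambda>x. F x + G x) \<in> C_infinity \<A>"
  unfolding C_infinity_def mem_Collect_eq comp_def smooth_on_def
proof safe
  fix U \<kappa> k assume c: "(U, \<kappa>) \<in> \<A>"
  have "Ck_on k (\<kappa> ` U) (F \<circ> inv_into U \<kappa>)" "Ck_on k (\<kappa> ` U) (G \<circ> inv_into U \<kappa>)"
    using c assms(2,3) by (auto simp: C_infinity_def smooth_on_def)
  from Ck_on_add[OF smooth_atlas_open_image[OF assms(1) c] this]
  show "Ck_on k (\<kappa> ` U) (\<lambda>x. F (inv_into U \<kappa> x) + G (inv_into U \<kappa> x))"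
    by (simp add: comp_def)
qed

lemma C_infinity_mult:
  assumes "smooth_atlas \<A>" "F \<in> C_infinity \<A>" "G \<in> C_infinity \<A>"
  shows "(\<lambda>x. F x * G x) \<in> C_infinity \<A>"
  unfolding C_infinity_def mem_Collect_eq comp_def smooth_on_def
proof safe
  fix U \<kappa> k assume c: "(U, \<kappa>) \<in> \<A>"
  have "Ck_on k (\<kappa> ` U) (F \<circ> inv_into U \<kappa>)" "Ck_on k (\<kappa> ` U) (G \<circ> inv_into U \<kappa>)"
    using c assms(2,3) by (auto simp: C_infinity_def smooth_on_def)
  from Ck_on_mult[OF smooth_atlas_open_image[OF assms(1) c] this]
  show "Ck_on k (\<kappa> ` U) (\<lambda>x. F (inv_into U \<kappa> x) * G (inv_into U \<kappa> x))"
    by (simp add: comp_def)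
qed

lemma C_infinity_continuous:
  fixes \<A> :: "('a::t2_space, 'b::real_normed_vector) chart set"
  assumes "smooth_atlas \<A>" "F \<in> C_infinity \<A>"
  shows "continuous_on UNIV F"
proof -
  have "isCont F p" for p
  proof -
    obtain U \<kappa> where c: "(U, \<kappa>) \<in> \<A>" "p \<in> U"
      using assms(1) unfolding smooth_atlas_def by blast
    have ch: "open U" "homeomorphism U (\<kappa> ` U) \<kappa> (inv_into U \<kappa>)"
      using assms(1) c by (auto simp: smooth_atlas_def is_chart_def)
    have "smooth_on (\<kappa> ` U) (F \<circ> inv_into U \<kappa>)"
      using assms(2) c by (auto simp: C_infinity_def)
    then have "continuous_on (\<kappa> ` U) (F \<circ> inv_into U \<kappa>)"
      unfolding smooth_on_def by (metis Ck_on.simps(1))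
    moreover have "continuous_on U \<kappa>" using ch(2) by (simp add: homeomorphism_def)
    ultimately have "continuous_on U ((F \<circ> inv_into U \<kappa>) \<circ> \<kappa>)"
      by (rule continuous_on_compose[rotated])
    then have "continuous_on U F"
      using ch(2) by (subst continuous_on_cong[OF refl]) (auto simp: homeomorphism_def)
    then show ?thesis using ch(1) c(2) by (simp add: continuous_on_eq_continuous_at)
  qed
  then show ?thesis by (simp add: continuous_at_imp_continuous_on)
qed

section \<open>Tangent vectors\<close>

lemma chart_inv:
  assumes "smooth_atlas \<A>" "(U, \<kappa>) \<in> \<A>" "p \<in> U"
  shows "inv_into U \<kappa> (\<kappa> p) = p"
  using assms by (auto simp: smooth_atlas_def is_chart_def homeomorphism_def)

lemma chart_differentiable:
  assumes "F \<in> C_infinity \<A>" "(U, \<kappa>) \<in> \<A>" "p \<in> U"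
  shows "(F \<circ> inv_into U \<kappa>) differentiable (at (\<kappa> p))"
  using assms by (auto simp: C_infinity_def intro!: smooth_on_differentiable[of "\<kappa> ` U"])

text \<open>
  The chain rule for the transition map. It allows all tangent vectors at a point to be
  computed in one chart, where they inherit the linear structure of the model space.
\<close>

lemma coord_vec_chart_change:
  assumes "smooth_atlas \<A>" "(U, \<kappa>) \<in> \<A>" "(V, \<mu>) \<in> \<A>" "p \<in> U" "p \<in> V"
  shows "coord_vec \<A> (V, \<mu>) p u
       = coord_vec \<A> (U, \<kappa>) p (frechet_derivative (\<kappa> \<circ> inv_into V \<mu>) (at (\<mu> p)) u)"
proof
  fix F
  let ?T = "\<kappa> \<circ> inv_into V \<mu>"
  show "coord_vec \<A> (V, \<mu>) p u F = coord_vec \<A> (U, \<kappa>) p (frechet_derivative ?T (at (\<mu> p)) u) F"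
  proof (cases "F \<in> C_infinity \<A>")
    case False
    then show ?thesis by (simp add: coord_vec_def)
  next
    case F: True
    let ?S = "\<mu> ` (V \<inter> U)"
    have hom: "homeomorphism V (\<mu> ` V) \<mu> (inv_into V \<mu>)" and op: "open V" "open U" "open (\<mu> ` V)"
      using assms by (auto simp: smooth_atlas_def is_chart_def)
    have "openin (top_of_set (\<mu> ` V)) ?S"
      using homeomorphism_imp_open_map[OF hom] op(1,2) by (auto simp: openin_open_eq)
    then have S: "open ?S" using op(3) openin_open_trans by blast
    have pS: "\<mu> p \<in> ?S" using assms by auto
    have "smooth_on ?S ?T" using assms unfolding smooth_atlas_def by blast
    then have dT: "(?T has_derivative frechet_derivative ?T (at (\<mu> p))) (at (\<mu> p))"
      using smooth_on_differentiable pS frechet_derivative_works by blast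
    have Tp: "?T (\<mu> p) = \<kappa> p" using chart_inv assms by fastforce
    have dF: "((F \<circ> inv_into U \<kappa>) has_derivative frechet_derivative (F \<circ> inv_into U \<kappa>) (at (\<kappa> p))) (at (?T (\<mu> p)))"
      unfolding Tp using chart_differentiable[OF F assms(2,4)] frechet_derivative_works by blast
    have "((F \<circ> inv_into U \<kappa>) \<circ> ?T has_derivative
        frechet_derivative (F \<circ> inv_into U \<kappa>) (at (\<kappa> p)) \<circ> frechet_derivative ?T (at (\<mu> p))) (at (\<mu> p))"
      by (rule diff_chain_at[OF dT dF])
    moreover have "((F \<circ> inv_into U \<kappa>) \<circ> ?T) y = (F \<circ> inv_into V \<mu>) y" if "y \<in> ?S" for y
      using that chart_inv[OF assms(1)] assms(2,3) by auto
    ultimately have "(F \<circ> inv_into V \<mu> has_derivative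
        frechet_derivative (F \<circ> inv_into U \<kappa>) (at (\<kappa> p)) \<circ> frechet_derivative ?T (at (\<mu> p))) (at (\<mu> p))"
      using has_derivative_transform_within_open[OF _ S pS] by blast
    then have "frechet_derivative (F \<circ> inv_into V \<mu>) (at (\<mu> p))
        = frechet_derivative (F \<circ> inv_into U \<kappa>) (at (\<kappa> p)) \<circ> frechet_derivative ?T (at (\<mu> p))"
      using frechet_derivative_at by metis
    then show ?thesis using F by (simp add: coord_vec_def)
  qed
qed

lemma tangent_space_one_chart:
  assumes "smooth_atlas \<A>" "(U, \<kappa>) \<in> \<A>" "p \<in> U"
  shows "tangent_space \<A> p = range (coord_vec \<A> (U, \<kappa>) p)"
proof
  show "tangent_space \<A> p \<subseteq> range (coord_vec \<A> (U, \<kappa>) p)"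
    using coord_vec_chart_change[OF assms(1,2) _ assms(3)] by (fastforce simp: tangent_space_def)
  show "range (coord_vec \<A> (U, \<kappa>) p) \<subseteq> tangent_space \<A> p"
    using assms(2,3) by (fastforce simp: tangent_space_def)
qed

lemma coord_vec_linear:
  assumes "(U, \<kappa>) \<in> \<A>" "p \<in> U"
  shows "linear (\<lambda>u. coord_vec \<A> (U, \<kappa>) p u F)"
proof (cases "F \<in> C_infinity \<A>")
  case True
  then show ?thesis
    using linear_frechet_derivative[OF chart_differentiable[OF True assms]]
    by (simp add: coord_vec_def)
qed (simp add: coord_vec_def module_hom_zero)

lemma tangent_vector_const:
  assumes "v \<in> tangent_space \<A> p" shows "v (\<lambda>_. c) = 0"
  using assms by (auto simp: tangent_space_def coord_vec_def comp_def)

lemma tangent_vector_add: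
  assumes "smooth_atlas \<A>" "v \<in> tangent_space \<A> p" "F \<in> C_infinity \<A>" "G \<in> C_infinity \<A>"
  shows "v (\<lambda>x. F x + G x) = v F + v G"
proof -
  obtain U \<kappa> u where c: "(U, \<kappa>) \<in> \<A>" "p \<in> U" "v = coord_vec \<A> (U, \<kappa>) p u"
    using assms(2) by (auto simp: tangent_space_def)
  show ?thesis
    using frechet_derivative_add[OF chart_differentiable[OF assms(3) c(1,2)] chart_differentiable[OF assms(4) c(1,2)]]
      C_infinity_add[OF assms(1,3,4)] assms(3,4)
    by (simp add: c(3) coord_vec_def comp_def)
qed

lemma tangent_vector_mult:
  assumes "smooth_atlas \<A>" "v \<in> tangent_space \<A> p" "F \<in> C_infinity \<A>" "G \<in> C_infinity \<A>"
  shows "v (\<lambda>x. F x * G x) = F p * v G + v F * G p"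
proof -
  obtain U \<kappa> u where c: "(U, \<kappa>) \<in> \<A>" "p \<in> U" "v = coord_vec \<A> (U, \<kappa>) p u"
    using assms(2) by (auto simp: tangent_space_def)
  show ?thesis
    using frechet_derivative_mult_real[OF chart_differentiable[OF assms(3) c(1,2)] chart_differentiable[OF assms(4) c(1,2)]]
      C_infinity_mult[OF assms(1,3,4)] assms(3,4) chart_inv[OF assms(1) c(1,2)]
    by (simp add: c(3) coord_vec_def comp_def)
qed

section \<open>Hamiltonian vector fields and the Poisson bracket\<close>

text \<open>
  A functional that vanishes on the common kernel of finitely many functionals is a linear
  combination of them. This turns nondegeneracy of the symplectic form into solvability of the
  equation for the Hamiltonian vector field, without choosing bases or comparing dimensions.
\<close>

lemma linear_functional_in_span_of_kernels:
  fixes f :: "'i \<Rightarrow> 'v::real_vector \<Rightarrow> real"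
  assumes "finite I" "\<And>i. i \<in> I \<Longrightarrow> linear (f i)" "linear l"
    and "\<And>v. (\<And>i. i \<in> I \<Longrightarrow> f i v = 0) \<Longrightarrow> l v = 0"
  shows "\<exists>c. \<forall>v. l v = (\<Sum>i\<in>I. c i * f i v)"
  using assms
proof (induction I arbitrary: l rule: finite_induct)
  case empty
  then show ?case by auto
next
  case (insert i I)
  note li = insert.prems(1)[of i, simplified] and ll = insert.prems(2)
  have "\<exists>d. \<forall>v. (\<forall>j\<in>I. f j v = 0) \<longrightarrow> l v - d * f i v = 0"
  proof (cases "\<exists>w. (\<forall>j\<in>I. f j w = 0) \<and> f i w \<noteq> 0")
    case False
    then have "\<forall>v. (\<forall>j\<in>I. f j v = 0) \<longrightarrow> l v - 0 * f i v = 0"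
      using insert.prems(3) by auto
    then show ?thesis by blast
  next
    case True
    then obtain w where w: "\<And>j. j \<in> I \<Longrightarrow> f j w = 0" "f i w \<noteq> 0" by blast
    have "l v - (l w / f i w) * f i v = 0" if v: "\<forall>j\<in>I. f j v = 0" for v
    proof -
      \<comment> \<open>Move \<open>v\<close> along \<open>w\<close> into the kernel of \<open>f i\<close>.\<close>
      have "f j (v - (f i v / f i w) *\<^sub>R w) = 0" if "j \<in> insert i I" for j
        using insert.prems(1)[OF that] w v that by (auto simp: linear_diff linear_scale)
      then have "l (v - (f i v / f i w) *\<^sub>R w) = 0" by (rule insert.prems(3))
      then show ?thesis using ll by (simp add: linear_diff linear_scale field_simps)
    qed
    then show ?thesis by blast
  qed
  then obtain d where d: "\<And>v. (\<And>j. j \<in> I \<Longrightarrow> f j v = 0) \<Longrightarrow> l v - d * f i v = 0" by blast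
  have "linear (\<lambda>v. l v - d * f i v)"
    using ll li by (auto intro!: linearI simp: linear_add linear_scale algebra_simps)
  then have "\<exists>c. \<forall>v. l v - d * f i v = (\<Sum>j\<in>I. c j * f j v)"
    by (rule insert.IH[rotated]) (simp_all add: insert.prems(1) d)
  then obtain c where c: "\<forall>v. l v - d * f i v = (\<Sum>j\<in>I. c j * f j v)" ..
  have "\<forall>v. l v = (\<Sum>j\<in>insert i I. (c(i := d)) j * f j v)"
  proof
    fix v
    have "(\<Sum>j\<in>I. (c(i := d)) j * f j v) = (\<Sum>j\<in>I. c j * f j v)"
      using insert.hyps by (intro sum.cong) auto
    then show "l v = (\<Sum>j\<in>insert i I. (c(i := d)) j * f j v)"
      using c insert.hyps by (simp add: algebra_simps)
  qed
  then show ?case by blast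
qed

lemma symplectic_atlas: "closed_symplectic_manifold \<A> \<omega> \<Longrightarrow> smooth_atlas \<A>"
  by (simp add: closed_symplectic_manifold_def closed_manifold_def)

lemma symplectic_form_bilinear:
  assumes "closed_symplectic_manifold \<A> \<omega>" "(U, \<kappa>) \<in> \<A>" "p \<in> U"
  shows "bilinear (\<lambda>u v. \<omega> p (coord_vec \<A> (U, \<kappa>) p u) (coord_vec \<A> (U, \<kappa>) p v))"
proof -
  have "bilinear (form_in_chart \<A> \<omega> (U, \<kappa>) (\<kappa> p))"
    using assms by (fastforce simp: closed_symplectic_manifold_def smooth_2form_def)
  then show ?thesis
    using chart_inv[OF symplectic_atlas[OF assms(1)] assms(2,3)]
    by (simp add: form_in_chart_def[abs_def] Let_def)
qed

text \<open>
  The form is only given as alternating, and bilinear in charts; polarization has to take place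
  in a single chart that represents both vectors.
\<close>

lemma symplectic_form_antisym:
  assumes "closed_symplectic_manifold \<A> \<omega>" "v \<in> tangent_space \<A> p" "w \<in> tangent_space \<A> p"
  shows "\<omega> p v w = - \<omega> p w v"
proof -
  note at = symplectic_atlas[OF assms(1)]
  obtain U \<kappa> where c: "(U, \<kappa>) \<in> \<A>" "p \<in> U" using at unfolding smooth_atlas_def by blast
  let ?cv = "coord_vec \<A> (U, \<kappa>) p"
  obtain a b where ab: "v = ?cv a" "w = ?cv b"
    using assms(2,3) tangent_space_one_chart[OF at c] by auto
  note bl = symplectic_form_bilinear[OF assms(1) c]
  have "\<omega> p (?cv u) (?cv u) = 0" for u
    using assms(1) tangent_space_one_chart[OF at c]
    by (auto simp: closed_symplectic_manifold_def smooth_2form_def)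
  from this[of "a + b"] this[of a] this[of b] show ?thesis
    using bilinear_ladd[OF bl] bilinear_radd[OF bl] by (simp add: ab)
qed

text \<open>
  In a chart, consider \<open>b(u, v) = \<omega>(u, v)\<close> and the functional \<open>v \<mapsto> - v F\<close> on the model space.
  By nondegeneracy, a \<open>v\<close> in the radical of \<open>b\<close> represents the zero tangent vector, so the
  functional vanishes on it. Hence the functional is a combination of the \<open>b(e, \<cdot>)\<close> for \<open>e\<close> in a
  finite spanning set, that is, \<open>b(u, \<cdot>)\<close> for some \<open>u\<close>. Working modulo the radical makes it
  possible to argue without linear independence of the coordinate vectors as derivations,
  which would call for bump functions.
\<close>

lemma ham_vec_exists1:
  assumes "closed_symplectic_manifold \<A> \<omega>"
  shows "\<exists>!v. v \<in> tangent_space \<A> p \<and> (\<forall>w\<in>tangent_space \<A> p. \<omega> p v w = - w F)"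
proof -
  note at = symplectic_atlas[OF assms(1)]
  obtain U \<kappa> where c: "(U, \<kappa>) \<in> \<A>" "p \<in> U" using at unfolding smooth_atlas_def by blast
  let ?cv = "coord_vec \<A> (U, \<kappa>) p"
  let ?b = "\<lambda>u v. \<omega> p (?cv u) (?cv v)"
  note T = tangent_space_one_chart[OF at c]
  note bl = symplectic_form_bilinear[OF assms(1) c]
  note lin = coord_vec_linear[OF c]
  have nondeg: "?cv u = (\<lambda>_. 0)" if "\<And>v. ?b u v = 0" for u
  proof -
    have "\<forall>w\<in>tangent_space \<A> p. \<omega> p (?cv u) w = 0" using that T by auto
    moreover have "?cv u \<in> tangent_space \<A> p" using T by blast
    ultimately show ?thesis
      using assms unfolding closed_symplectic_manifold_def nondegenerate_2form_def by blast
  qed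
  obtain B :: "'b set" where B: "finite B" "span B = UNIV"
    using assms by (auto simp: closed_symplectic_manifold_def closed_manifold_def)
  have "\<exists>k. \<forall>v. - ?cv v F = (\<Sum>e\<in>B. k e * ?b e v)"
  proof (rule linear_functional_in_span_of_kernels[OF B(1)])
    show "linear (?b e)" for e using bl by (simp add: bilinear_def)
    show "linear (\<lambda>v. - ?cv v F)" using lin[of F] by (rule linear_compose_neg)
    fix v assume "\<And>e. e \<in> B \<Longrightarrow> ?b e v = 0"
    moreover have "linear (\<lambda>u. ?b u v)" using bl by (simp add: bilinear_def)
    ultimately have "?b u v = 0" for u
      using linear_eq_0_on_span[of "\<lambda>u. ?b u v" B u] B(2) by auto
    then have "?b v u = 0" for u
      using symplectic_form_antisym[OF assms, of "?cv v" p "?cv u"] by (simp add: T)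
    then show "- ?cv v F = 0" using nondeg[of v] by simp
  qed
  then obtain k where k: "\<And>v. - ?cv v F = (\<Sum>e\<in>B. k e * ?b e v)" by blast
  let ?u = "\<Sum>e\<in>B. k e *\<^sub>R e"
  have u: "?b ?u v = - ?cv v F" for v
  proof -
    have "linear (\<lambda>u. ?b u v)" using bl by (simp add: bilinear_def)
    then have "?b ?u v = (\<Sum>e\<in>B. ?b (k e *\<^sub>R e) v)"
      by (rule linear_sum)
    then show ?thesis using bilinear_lmul[OF bl] by (simp add: k)
  qed
  show ?thesis
  proof (rule ex1I[of _ "?cv ?u"])
    show "?cv ?u \<in> tangent_space \<A> p \<and> (\<forall>w\<in>tangent_space \<A> p. \<omega> p (?cv ?u) w = - w F)"
      using u by (auto simp: T)
    fix v assume v: "v \<in> tangent_space \<A> p \<and> (\<forall>w\<in>tangent_space \<A> p. \<omega> p v w = - w F)"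
    then obtain u' where u': "v = ?cv u'" by (auto simp: T)
    have "?b (u' - ?u) w = 0" for w
      using v u[of w] bilinear_lsub[OF bl, of u' ?u w] by (auto simp: T u')
    then have "?cv (u' - ?u) = (\<lambda>_. 0)" by (rule nondeg)
    moreover have "?cv (u' - ?u) G = ?cv u' G - ?cv ?u G" for G
      using lin by (rule linear_diff)
    ultimately have "?cv u' G = ?cv ?u G" for G by simp
    then show "v = ?cv ?u" unfolding u' by (rule ext)
  qed
qed

lemma ham_vec_tangent:
  assumes "closed_symplectic_manifold \<A> \<omega>"
  shows "ham_vec \<A> \<omega> F p \<in> tangent_space \<A> p"
  using theI'[OF ham_vec_exists1[OF assms]] by (simp add: ham_vec_def)

lemma poisson_bracket_eq_derivative:
  assumes "closed_symplectic_manifold \<A> \<omega>"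
  shows "poisson_bracket \<A> \<omega> F G p = - ham_vec \<A> \<omega> G p F"
  using theI'[OF ham_vec_exists1[OF assms, of p F]] ham_vec_tangent[OF assms, of G p]
  by (simp add: ham_vec_def poisson_bracket_def)

lemma poisson_bracket_antisym:
  assumes "closed_symplectic_manifold \<A> \<omega>"
  shows "poisson_bracket \<A> \<omega> F G p = - poisson_bracket \<A> \<omega> G F p"
  unfolding poisson_bracket_def
  by (rule symplectic_form_antisym[OF assms ham_vec_tangent[OF assms] ham_vec_tangent[OF assms]])

definition poisson_centralizer ::
    "('a::topological_space, 'b::real_normed_vector) chart set \<Rightarrow> ('a \<Rightarrow> 'a tvec \<Rightarrow> 'a tvec \<Rightarrow> real) \<Rightarrow>
     ('a \<Rightarrow> real) set \<Rightarrow> ('a \<Rightarrow> real) set" where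
  "poisson_centralizer \<A> \<omega> S = {F \<in> C_infinity \<A>. \<forall>G\<in>S. \<forall>p. poisson_bracket \<A> \<omega> F G p = 0}"

definition function_algebra :: "('a \<Rightarrow> real) set \<Rightarrow> bool" where
  "function_algebra R \<longleftrightarrow> (\<forall>c. (\<lambda>_. c) \<in> R) \<and>
     (\<forall>f\<in>R. \<forall>g\<in>R. (\<lambda>x. f x + g x) \<in> R \<and> (\<lambda>x. f x * g x) \<in> R)"

text \<open>
  \<open>F\<close> commutes with \<open>G\<close> iff the tangent vectors \<open>X\<^sub>G\<close> annihilate \<open>F\<close>, and tangent vectors are
  derivations.
\<close>

lemma poisson_centralizer_algebra:
  assumes "closed_symplectic_manifold \<A> \<omega>"
  shows "function_algebra (poisson_centralizer \<A> \<omega> S)"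
proof -
  note at = symplectic_atlas[OF assms] and X = ham_vec_tangent[OF assms]
  have Z: "F \<in> poisson_centralizer \<A> \<omega> S
      \<longleftrightarrow> F \<in> C_infinity \<A> \<and> (\<forall>G\<in>S. \<forall>p. ham_vec \<A> \<omega> G p F = 0)" for F
    by (simp add: poisson_centralizer_def poisson_bracket_eq_derivative[OF assms])
  have "(\<lambda>_. c) \<in> poisson_centralizer \<A> \<omega> S" for c
    unfolding Z by (simp add: C_infinity_const tangent_vector_const[OF X])
  moreover have "(\<lambda>x. F x + G x) \<in> poisson_centralizer \<A> \<omega> S \<and>
      (\<lambda>x. F x * G x) \<in> poisson_centralizer \<A> \<omega> S"
    if "F \<in> poisson_centralizer \<A> \<omega> S" "G \<in> poisson_centralizer \<A> \<omega> S" for F G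
    using that unfolding Z
    by (simp add: C_infinity_add[OF at] C_infinity_mult[OF at]
        tangent_vector_add[OF at X] tangent_vector_mult[OF at X])
  ultimately show ?thesis by (simp only: function_algebra_def) blast
qed

text \<open>
  The algebra is the second centralizer \<open>Z(Z(AA))\<close>. Commutativity of \<open>AA\<close> says \<open>AA \<subseteq> Z(AA)\<close>, hence
  \<open>Z(Z(AA)) \<subseteq> Z(AA)\<close>, and so any two elements of \<open>Z(Z(AA))\<close> commute. Being a centralizer, it is
  an algebra; this replaces an induction over polynomial expressions in \<open>AA\<close>.
\<close>

lemma poisson_commutative_in_commutative_algebra:
  assumes "closed_symplectic_manifold \<A> \<omega>" "AA \<subseteq> C_infinity \<A>"
    and "\<And>F G p. F \<in> AA \<Longrightarrow> G \<in> AA \<Longrightarrow> poisson_bracket \<A> \<omega> F G p = 0"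
  obtains R where "AA \<subseteq> R" "R \<subseteq> C_infinity \<A>" "function_algebra R"
    "\<And>F G p. F \<in> R \<Longrightarrow> G \<in> R \<Longrightarrow> poisson_bracket \<A> \<omega> F G p = 0"
proof
  let ?Z = "poisson_centralizer \<A> \<omega>"
  have Z: "AA \<subseteq> ?Z AA" using assms(2,3) by (auto simp: poisson_centralizer_def)
  have comm: "poisson_bracket \<A> \<omega> F G p = 0" if "F \<in> ?Z S" "G \<in> S" for F G S p
    using that by (simp add: poisson_centralizer_def)
  show "AA \<subseteq> ?Z (?Z AA)"
  proof
    fix F assume F: "F \<in> AA"
    have "poisson_bracket \<A> \<omega> F G p = 0" if "G \<in> ?Z AA" for G p
      using poisson_bracket_antisym[OF assms(1), of F G p] comm[OF that F, of p] by simp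
    then show "F \<in> ?Z (?Z AA)"
      using F assms(2) by (auto simp: poisson_centralizer_def[of \<A> \<omega> "?Z AA"])
  qed
  show "?Z (?Z AA) \<subseteq> C_infinity \<A>" by (auto simp: poisson_centralizer_def)
  show "function_algebra (?Z (?Z AA))" by (rule poisson_centralizer_algebra[OF assms(1)])
  show "poisson_bracket \<A> \<omega> F G p = 0" if "F \<in> ?Z (?Z AA)" "G \<in> ?Z (?Z AA)" for F G p
  proof (rule comm[OF that(1)])
    have "G \<in> C_infinity \<A>" using that(2) by (simp add: poisson_centralizer_def)
    moreover have "poisson_bracket \<A> \<omega> G F p = 0" if "F \<in> AA" for F p
      using comm[OF \<open>G \<in> ?Z (?Z AA)\<close>] Z that by blast
    ultimately show "G \<in> ?Z AA" by (simp add: poisson_centralizer_def[of \<A> \<omega> AA])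
  qed
qed

section \<open>Heaviness and the quasi-measure\<close>

lemma quasi_state_const:
  assumes "partial_symplectic_quasi_state \<A> \<omega> \<zeta>"
  shows "\<zeta> (\<lambda>_. c) = c"
  by (rule assms[unfolded partial_symplectic_quasi_state_def, THEN conjunct1, THEN spec])

lemma quasi_state_stability:
  assumes "partial_symplectic_quasi_state \<A> \<omega> \<zeta>" "H \<in> C_functions" "K \<in> C_functions"
  shows "(INF x. H x - K x) \<le> \<zeta> H - \<zeta> K" "\<zeta> H - \<zeta> K \<le> (SUP x. H x - K x)"
proof -
  note stab = assms(1)[unfolded partial_symplectic_quasi_state_def, THEN conjunct2, THEN conjunct1,
      THEN bspec, OF assms(2), THEN bspec, OF assms(3)]
  show "(INF x. H x - K x) \<le> \<zeta> H - \<zeta> K" by (rule stab[THEN conjunct1])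
  show "\<zeta> H - \<zeta> K \<le> (SUP x. H x - K x)" by (rule stab[THEN conjunct2])
qed

lemma quasi_state_scale:
  assumes "partial_symplectic_quasi_state \<A> \<omega> \<zeta>" "H \<in> C_functions" "s > 0"
  shows "\<zeta> (\<lambda>x. s * H x) = s * \<zeta> H"
  using assms(3)
  by (rule assms(1)[unfolded partial_symplectic_quasi_state_def, THEN conjunct2, THEN conjunct2,
      THEN conjunct1, THEN bspec, OF assms(2), rule_format])

lemma quasi_state_subadd:
  assumes "partial_symplectic_quasi_state \<A> \<omega> \<zeta>" "H \<in> C_infinity \<A>" "K \<in> C_infinity \<A>"
    and "\<And>p. poisson_bracket \<A> \<omega> H K p = 0"
  shows "\<zeta> (\<lambda>x. H x + K x) \<le> \<zeta> H + \<zeta> K"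
  using assms(4)
  by (intro assms(1)[unfolded partial_symplectic_quasi_state_def, THEN conjunct2, THEN conjunct2,
      THEN conjunct2, THEN conjunct2, THEN conjunct2, THEN bspec, OF assms(2), THEN bspec, OF assms(3),
      THEN mp] allI)

lemma quasi_state_mono:
  assumes "partial_symplectic_quasi_state \<A> \<omega> \<zeta>" "H \<in> C_functions" "K \<in> C_functions"
    and "\<And>x. H x \<le> K x"
  shows "\<zeta> H \<le> \<zeta> K"
proof -
  have "\<zeta> H - \<zeta> K \<le> (SUP x. H x - K x)"
    by (rule quasi_state_stability(2)[OF assms(1-3)])
  also have "\<dots> \<le> 0" using assms(4) by (intro cSUP_least) auto
  finally show ?thesis by simp
qed

lemma quasi_state_affine:
  assumes "partial_symplectic_quasi_state \<A> \<omega> \<zeta>" "H \<in> C_functions" "s > 0"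
  shows "\<zeta> (\<lambda>x. s * H x + c) = s * \<zeta> H + c"
proof -
  let ?K = "\<lambda>x. s * H x"
  have C: "?K \<in> C_functions" "(\<lambda>x. ?K x + c) \<in> C_functions"
    using assms(2) by (auto simp: C_functions_def intro!: continuous_intros)
  have "\<zeta> (\<lambda>x. ?K x + c) = \<zeta> ?K + c"
    using quasi_state_stability[OF assms(1) C(2,1)] by simp
  then show ?thesis by (simp add: quasi_state_scale[OF assms])
qed

lemma tau_le:
  assumes "partial_symplectic_quasi_state \<A> \<omega> \<zeta>"
    and "a \<in> C_functions" "\<And>x. 0 \<le> a x" "\<And>x. a x \<le> 1" "\<And>x. x \<in> X \<Longrightarrow> a x = 1"
  shows "tau \<zeta> X \<le> \<zeta> a"
  unfolding tau_def
proof (rule cInf_lower)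
  show "\<zeta> a \<in> {\<zeta> a | a. a \<in> C_functions \<and> range a \<subseteq> {0..1} \<and> (\<forall>x\<in>X. a x = 1)}"
    using assms(2-5) by auto
  have "0 \<le> \<zeta> a" if "a \<in> C_functions" "range a \<subseteq> {0..1}" for a
    using quasi_state_mono[OF assms(1) _ that(1), of "\<lambda>_. 0"] quasi_state_const[OF assms(1), of 0] that(2)
    by (force simp: C_functions_def)
  then show "bdd_below {\<zeta> a | a. a \<in> C_functions \<and> range a \<subseteq> {0..1} \<and> (\<forall>x\<in>X. a x = 1)}"
    by (intro bdd_belowI[of _ 0]) blast
qed

lemma tau_lessE:
  assumes "tau \<zeta> X < e"
  obtains a where "a \<in> C_functions" "\<And>x. 0 \<le> a x" "\<And>x. a x \<le> 1" "\<And>x. x \<in> X \<Longrightarrow> a x = 1" "\<zeta> a < e"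
proof -
  let ?S = "{\<zeta> a | a. a \<in> C_functions \<and> range a \<subseteq> {0..1} \<and> (\<forall>x\<in>X. a x = 1)}"
  have "\<zeta> (\<lambda>_. 1) \<in> ?S" by (auto simp: C_functions_def)
  then have "?S \<noteq> {}" by blast
  then obtain y where "y \<in> ?S" "y < e" using cInf_lessD[of ?S e] assms unfolding tau_def by auto
  then obtain a where "a \<in> C_functions" "range a \<subseteq> {0..1}" "\<forall>x\<in>X. a x = 1" "\<zeta> a < e" by blast
  then show thesis by (intro that[of a]) (auto simp: image_subset_iff)
qed

text \<open>
  Given \<open>H\<close> with minimum \<open>m\<close> over \<open>X\<close>, cut it off above at \<open>m\<close> and rescale affinely to a function
  \<open>a\<close> with values in \<open>[0,1]\<close> and \<open>a = 1\<close> on \<open>X\<close>. Then \<open>\<zeta>(a) \<ge> 1\<close>, which scales back to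
  \<open>\<zeta>(H) \<ge> \<zeta>(min(H, m)) \<ge> m\<close>.
\<close>

lemma heavy_if_tau_1:
  fixes \<zeta> :: "('a::topological_space \<Rightarrow> real) \<Rightarrow> real"
  assumes \<zeta>: "partial_symplectic_quasi_state \<A> \<omega> \<zeta>" and "compact (UNIV :: 'a set)"
    and X: "closed X" "X \<noteq> {}" and "1 \<le> tau \<zeta> X"
  shows "heavy \<zeta> X"
  unfolding heavy_def
proof (intro conjI ballI)
  fix H :: "'a \<Rightarrow> real" assume H: "H \<in> C_functions"
  then have cont: "continuous_on A H" for A
    using continuous_on_subset[of UNIV H A] by (simp add: C_functions_def)
  have "compact X" using compact_Int_closed[OF assms(2) X(1)] by simp
  then obtain x0 where x0: "x0 \<in> X" "\<And>x. x \<in> X \<Longrightarrow> H x0 \<le> H x"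
    using continuous_attains_inf[OF _ X(2) cont] by blast
  obtain x1 where x1: "\<And>x. H x1 \<le> H x"
    using continuous_attains_inf[OF assms(2) _ cont] by blast
  \<comment> \<open>Subtracting 1 keeps \<open>?m - ?c\<close> positive when \<open>X\<close> contains a global minimum of \<open>H\<close>.\<close>
  let ?m = "H x0" and ?c = "H x1 - 1"
  let ?a = "\<lambda>x. (min (H x) ?m - ?c) / (?m - ?c)"
  have pos: "?m - ?c > 0" using x1[of x0] by simp
  have a: "?a \<in> C_functions"
    using H pos by (auto simp: C_functions_def intro!: continuous_intros)
  have "tau \<zeta> X \<le> \<zeta> ?a"
  proof (rule tau_le[OF \<zeta> a])
    show "0 \<le> ?a x" for x using pos x1[of x] x1[of x0] by (intro divide_nonneg_pos) auto
    show "?a x \<le> 1" for x using pos by (simp add: divide_le_eq_1)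
    show "?a x = 1" if "x \<in> X" for x using pos x0(2)[OF that] by (simp add: min_def)
  qed
  then have "1 \<le> \<zeta> ?a" using assms(5) by linarith
  then have "(?m - ?c) * 1 \<le> (?m - ?c) * \<zeta> ?a"
    using pos by (intro mult_left_mono) auto
  then have "?m \<le> (?m - ?c) * \<zeta> ?a + ?c"
    by (simp only: mult_1_right diff_le_eq)
  also have "\<dots> = \<zeta> (\<lambda>x. (?m - ?c) * ?a x + ?c)"
    by (rule quasi_state_affine[OF \<zeta> a pos, symmetric])
  also have "(\<lambda>x. (?m - ?c) * ?a x + ?c) = (\<lambda>x. min (H x) ?m)" using pos by auto
  also have "\<zeta> (\<lambda>x. min (H x) ?m) \<le> \<zeta> H"
    using H by (intro quasi_state_mono[OF \<zeta>]) (auto simp: C_functions_def intro!: continuous_intros)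
  finally have "ereal ?m \<le> ereal (\<zeta> H)" by simp
  moreover have "(INF x\<in>X. ereal (H x)) \<le> ereal ?m" using x0(1) by (rule INF_lower)
  ultimately show "(INF x\<in>X. ereal (H x)) \<le> ereal (\<zeta> H)" by (rule order_trans[rotated])
qed (rule X(1))

text \<open>
  If \<open>\<zeta>(a) < 1/4\<close> and \<open>a = 1\<close> on \<open>{u = 1}\<close>, then \<open>min 1 (2 a)\<close> shows that \<open>\<tau> < 1\<close> on
  \<open>{a \<ge> 1/2}\<close>, and simplicity improves this to \<open>\<tau> = 0\<close>. By compactness \<open>{a > 1/2}\<close> contains a
  superlevel set of \<open>u\<close>.
\<close>

lemma simple_tau_nbhd:
  fixes \<zeta> :: "('a::topological_space \<Rightarrow> real) \<Rightarrow> real"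
  assumes \<zeta>: "partial_symplectic_quasi_state \<A> \<omega> \<zeta>" "simple \<zeta>" and cpt: "compact (UNIV :: 'a set)"
    and u: "u \<in> C_functions" "\<And>x. u x \<le> 1"
    and tau0: "tau \<zeta> {x. u x = 1} = 0"
  obtains b :: real where "0 < b" "b < 1" "tau \<zeta> {x. b \<le> u x} = 0"
proof -
  obtain a where a: "a \<in> C_functions" "\<And>x. 0 \<le> a x" "\<And>x. u x = 1 \<Longrightarrow> a x = 1" "\<zeta> a < 1/4"
    by (rule tau_lessE[of \<zeta> "{x. u x = 1}" "1/4"]) (auto simp: tau0)
  have "\<exists>b. 0 < b \<and> b < 1 \<and> (\<forall>x. a x \<le> 1/2 \<longrightarrow> u x < b)"
  proof (cases "{x. a x \<le> 1/2} = {}")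
    case True
    then show ?thesis by (intro exI[of _ "1/2"]) auto
  next
    case False
    have "closed {x. a x \<le> 1/2}"
      using a(1) by (auto simp: C_functions_def intro!: closed_Collect_le continuous_intros)
    then have "compact {x. a x \<le> 1/2}" using compact_Int_closed[OF cpt] by simp
    then obtain x0 where x0: "a x0 \<le> 1/2" "\<And>x. a x \<le> 1/2 \<Longrightarrow> u x \<le> u x0"
      using continuous_attains_sup[OF _ False, of u] u(1) continuous_on_subset[of UNIV u "{x. a x \<le> 1/2}"]
      by (auto simp: C_functions_def)
    have "u x0 < 1" using u(2)[of x0] a(3)[of x0] x0(1) by force
    then obtain b where "max 0 (u x0) < b" "b < 1" using dense[of "max 0 (u x0)" 1] by auto
    then show ?thesis using x0(2) by (intro exI[of _ b]) force
  qed
  then obtain b where b: "0 < b" "b < 1" "\<And>x. a x \<le> 1/2 \<Longrightarrow> u x < b" by blast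
  let ?a = "\<lambda>x. min 1 (2 * a x)"
  have a': "?a \<in> C_functions" using a(1) by (auto simp: C_functions_def intro!: continuous_intros)
  have "tau \<zeta> {x. b \<le> u x} \<le> \<zeta> ?a"
  proof (rule tau_le[OF \<zeta>(1) a'])
    show "0 \<le> ?a x" for x using a(2)[of x] by simp
    show "?a x \<le> 1" for x by simp
    show "?a x = 1" if "x \<in> {x. b \<le> u x}" for x
      using that b(3)[of x] by (cases "a x \<le> 1/2") auto
  qed
  also have "\<dots> \<le> \<zeta> (\<lambda>x. 2 * a x + 0)"
    using a(1) by (intro quasi_state_mono[OF \<zeta>(1) a']) (auto simp: C_functions_def intro!: continuous_intros)
  also have "\<dots> < 1" using quasi_state_affine[OF \<zeta>(1) a(1), of 2 0] a(4) by simp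
  finally have "tau \<zeta> {x. b \<le> u x} \<noteq> 1" by simp
  moreover have "closed {x. b \<le> u x}"
    using u(1) by (auto simp: C_functions_def intro!: closed_Collect_le continuous_intros)
  ultimately have "tau \<zeta> {x. b \<le> u x} = 0" using \<zeta>(2) by (auto simp: simple_def)
  then show thesis using that b(1,2) by blast
qed

text \<open>
  \<open>f\<close> is dominated by \<open>C a + e\<close> for every \<open>a\<close> that equals 1 on \<open>X\<close>, and \<open>\<zeta>(a)\<close> can be made
  small compared with \<open>1 / C\<close>.
\<close>

lemma quasi_state_le_of_tau_0:
  assumes \<zeta>: "partial_symplectic_quasi_state \<A> \<omega> \<zeta>" and "tau \<zeta> X = 0"
    and f: "f \<in> C_functions" "\<And>x. f x \<le> C" "\<And>x. x \<notin> X \<Longrightarrow> f x \<le> e"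
  shows "\<zeta> f \<le> e"
proof (rule field_le_epsilon)
  fix d :: real assume "d > 0"
  \<comment> \<open>Positive, and large enough that \<open>C \<le> ?C + e\<close> whatever the sign of \<open>e\<close>.\<close>
  let ?C = "\<bar>C\<bar> + \<bar>e\<bar> + 1"
  have C: "?C > 0" by linarith
  obtain a where a: "a \<in> C_functions" "\<And>x. 0 \<le> a x" "\<And>x. x \<in> X \<Longrightarrow> a x = 1" "\<zeta> a < d / ?C"
    by (rule tau_lessE[of \<zeta> X "d / ?C"]) (use assms(2) \<open>d > 0\<close> C in auto)
  have "\<zeta> f \<le> \<zeta> (\<lambda>x. ?C * a x + e)"
  proof (rule quasi_state_mono[OF \<zeta> f(1)])
    show "(\<lambda>x. ?C * a x + e) \<in> C_functions"
      using a(1) by (auto simp: C_functions_def intro!: continuous_intros)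
    show "f x \<le> ?C * a x + e" for x
    proof (cases "x \<in> X")
      case True
      then show ?thesis using f(2)[of x] a(3)[OF True] by auto
    next
      case False
      have "0 \<le> ?C * a x" using a(2)[of x] C by (intro mult_nonneg_nonneg) auto
      then show ?thesis using f(3)[OF False] by linarith
    qed
  qed
  also have "\<dots> = ?C * \<zeta> a + e" by (rule quasi_state_affine[OF \<zeta> a(1) C])
  also have "\<dots> \<le> e + d" using a(4) C by (simp add: field_simps)
  finally show "\<zeta> f \<le> e + d" .
qed

section \<open>Peak functions and the covering argument\<close>

lemma function_algebraD:
  assumes "function_algebra R"
  shows "(\<lambda>_. c) \<in> R"
    and "f \<in> R \<Longrightarrow> g \<in> R \<Longrightarrow> (\<lambda>x. f x + g x) \<in> R"
    and "f \<in> R \<Longrightarrow> g \<in> R \<Longrightarrow> (\<lambda>x. f x * g x) \<in> R"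
  using assms unfolding function_algebra_def by blast+

lemma function_algebra_sum:
  assumes "function_algebra R" "\<And>i. i \<in> I \<Longrightarrow> f i \<in> R"
  shows "(\<lambda>x. \<Sum>i\<in>I. f i x) \<in> R"
  using assms(2)
proof (induction I rule: infinite_finite_induct)
  case (insert i I)
  then have "(\<lambda>x. f i x + (\<Sum>i\<in>I. f i x)) \<in> R"
    by (intro function_algebraD(2)[OF assms(1)]) auto
  with insert.hyps show ?case by simp
qed (simp_all add: function_algebraD(1)[OF assms(1)])

lemma function_algebra_power:
  assumes "function_algebra R" "f \<in> R"
  shows "(\<lambda>x. f x ^ k) \<in> R"
proof (induction k)
  case 0
  show ?case using function_algebraD(1)[OF assms(1), of 1] by simp
next
  case (Suc k)
  then show ?case using function_algebraD(3)[OF assms(1,2) Suc] by simp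
qed

lemma function_algebra_scale_shift:
  assumes "function_algebra R" "f \<in> R"
  shows "(\<lambda>x. s * f x + c) \<in> R"
  by (rule function_algebraD(2)[OF assms(1) function_algebraD(3)[OF assms(1) function_algebraD(1)[OF assms(1)] assms(2)]
        function_algebraD(1)[OF assms(1)]])

text \<open>
  The function is \<open>1 - h / C\<close>, where \<open>h\<close> is the sum of the squares \<open>(F - F p)\<^sup>2\<close> over \<open>F \<in> B\<close> and
  the constant \<open>C\<close> exceeds the maximum of \<open>h\<close>.
\<close>

lemma peak_function:
  fixes R :: "('a::topological_space \<Rightarrow> real) set"
  assumes "compact (UNIV :: 'a set)" and R: "function_algebra R" "R \<subseteq> C_functions"
    and B: "finite B" "B \<subseteq> R"
  obtains u where "u \<in> R" "\<And>x. 0 \<le> u x" "\<And>x. u x \<le> 1"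
    "\<And>x. u x = 1 \<longleftrightarrow> (\<forall>F\<in>B. F x = F p)"
proof -
  \<comment> \<open>The affine form \<open>1 * F x + (- F p)\<close> matches the closure property of \<open>R\<close> used below.\<close>
  let ?h = "\<lambda>x. \<Sum>F\<in>B. (1 * F x + (- F p)) ^ 2"
  have hR: "?h \<in> R"
    using B(2) by (intro function_algebra_sum[OF R(1)] function_algebra_power[OF R(1)]
        function_algebra_scale_shift[OF R(1)]) auto
  then have "continuous_on UNIV ?h" using R(2) by (auto simp: C_functions_def)
  then obtain x1 where x1: "\<And>x. ?h x \<le> ?h x1"
    using continuous_attains_sup[OF assms(1), of ?h] by blast
  let ?C = "?h x1 + 1"
  have h0: "0 \<le> ?h x" for x by (intro sum_nonneg) simp
  have C: "?C > 0" using h0[of x1] by linarith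
  let ?u = "\<lambda>x. (- 1 / ?C) * ?h x + 1"
  show thesis
  proof
    show "?u \<in> R" by (rule function_algebra_scale_shift[OF R(1) hR])
    show "0 \<le> ?u x" for x using C x1[of x] by (simp add: field_simps)
    show "?u x \<le> 1" for x using C h0[of x] by (simp add: field_simps)
    have "?u x = 1 \<longleftrightarrow> ?h x = 0" for x using C by (simp add: field_simps)
    also have "?h x = 0 \<longleftrightarrow> (\<forall>F\<in>B. F x = F p)" for x
      by (subst sum_nonneg_eq_0_iff[OF B(1)]) auto
    finally show "?u x = 1 \<longleftrightarrow> (\<forall>F\<in>B. F x = F p)" for x .
  qed
qed

lemma quasi_state_sum_le:
  assumes \<zeta>: "partial_symplectic_quasi_state \<A> \<omega> \<zeta>"
    and R: "function_algebra R" "R \<subseteq> C_infinity \<A>"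
      "\<And>F G p. F \<in> R \<Longrightarrow> G \<in> R \<Longrightarrow> poisson_bracket \<A> \<omega> F G p = 0"
    and "finite I" "\<And>i. i \<in> I \<Longrightarrow> f i \<in> R"
  shows "\<zeta> (\<lambda>x. \<Sum>i\<in>I. f i x) \<le> (\<Sum>i\<in>I. \<zeta> (f i))"
  using assms(5,6)
proof (induction I rule: finite_induct)
  case empty
  then show ?case by (simp add: quasi_state_const[OF \<zeta>])
next
  case (insert i I)
  let ?s = "\<lambda>x. \<Sum>i\<in>I. f i x"
  have "f i \<in> R" "?s \<in> R"
    using insert.prems by (auto intro: function_algebra_sum[OF R(1)])
  then have "\<zeta> (\<lambda>x. f i x + ?s x) \<le> \<zeta> (f i) + \<zeta> ?s"
    using R(2,3) by (intro quasi_state_subadd[OF \<zeta>]) auto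
  then show ?case using insert by simp
qed

text \<open>
  The function \<open>(u / c)\<^sup>k\<close> is at least 1 on \<open>{u \<ge> c}\<close> and at most \<open>(b / c)\<^sup>k\<close> off \<open>{u \<ge> b}\<close>. It
  may grow with \<open>k\<close>, but only on the set \<open>{u \<ge> b}\<close>, where \<open>\<tau> = 0\<close> makes it harmless.
\<close>

lemma sharpened_peak:
  fixes \<zeta> :: "('a::topological_space \<Rightarrow> real) \<Rightarrow> real"
  assumes \<zeta>: "partial_symplectic_quasi_state \<A> \<omega> \<zeta>"
    and R: "function_algebra R" "R \<subseteq> C_functions"
    and u: "u \<in> R" "\<And>x. 0 \<le> u x" "\<And>x. u x \<le> 1"
    and "0 < b" "b < c" "tau \<zeta> {x. b \<le> u x} = 0" "0 < e"
  obtains f where "f \<in> R" "\<And>x. 0 \<le> f x" "\<And>x. c \<le> u x \<Longrightarrow> 1 \<le> f x" "\<zeta> f \<le> e"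
proof -
  have c: "0 < c" using assms(7,8) by simp
  then obtain k where k: "(b / c) ^ k < e"
    using real_arch_pow_inv[of e "b / c"] assms(7,8,10) by auto
  let ?f = "\<lambda>x. (1 / c * u x + 0) ^ k"
  have fR: "?f \<in> R"
    by (intro function_algebra_power[OF R(1)] function_algebra_scale_shift[OF R(1)] u(1))
  show thesis
  proof
    show "?f \<in> R" by (rule fR)
    show "0 \<le> ?f x" for x using u(2)[of x] c by simp
    show "1 \<le> ?f x" if "c \<le> u x" for x using that c by (intro one_le_power) simp
    show "\<zeta> ?f \<le> e"
    proof (rule quasi_state_le_of_tau_0[OF \<zeta> assms(9)])
      show "?f \<in> C_functions" using fR R(2) by blast
      show "?f x \<le> (1 / c) ^ k" for x
        using u(2,3)[of x] c by (intro power_mono) (auto simp: divide_right_mono)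
      show "?f x \<le> e" if "x \<notin> {x. b \<le> u x}" for x
      proof -
        have "?f x \<le> (b / c) ^ k"
          using u(2)[of x] that c by (intro power_mono) (auto simp: divide_right_mono)
        then show ?thesis using k by simp
      qed
    qed
  qed
qed

text \<open>
  The sets with \<open>\<tau> = 0\<close> and the finite cover are fixed first, and only then the bound on
  \<open>\<zeta>\<close> of each sharpened peak, which depends on the number of members of the cover.
\<close>

lemma exists_fibre_tau_nonzero:
  fixes \<zeta> :: "('a::t2_space \<Rightarrow> real) \<Rightarrow> real"
  assumes \<zeta>: "partial_symplectic_quasi_state \<A> \<omega> \<zeta>" "simple \<zeta>" and cpt: "compact (UNIV :: 'a set)"
    and R: "function_algebra R" "R \<subseteq> C_infinity \<A>" "R \<subseteq> C_functions"
      "\<And>F G p. F \<in> R \<Longrightarrow> G \<in> R \<Longrightarrow> poisson_bracket \<A> \<omega> F G p = 0"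
    and B: "finite B" "B \<subseteq> R"
  shows "\<exists>p. tau \<zeta> {x. \<forall>F\<in>B. F x = F p} \<noteq> 0"
proof (rule ccontr)
  assume "\<not> ?thesis"
  then have tau0: "tau \<zeta> {x. \<forall>F\<in>B. F x = F p} = 0" for p by blast
  have "\<exists>u b c. u \<in> R \<and> (\<forall>x. 0 \<le> u x \<and> u x \<le> 1) \<and> 0 < b \<and> b < c \<and> c < u p \<and> tau \<zeta> {x. b \<le> u x} = 0" for p
  proof -
    obtain u where u: "u \<in> R" "\<And>x. 0 \<le> u x" "\<And>x. u x \<le> 1" "\<And>x. u x = 1 \<longleftrightarrow> (\<forall>F\<in>B. F x = F p)"
      using peak_function[OF cpt R(1,3) B, of p] by blast
    have up: "u p = 1" by (simp add: u(4))
    have uC: "u \<in> C_functions" using u(1) R(3) by blast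
    have ut: "tau \<zeta> {x. u x = 1} = 0" unfolding u(4) by (rule tau0)
    obtain b where b: "0 < b" "b < 1" "tau \<zeta> {x. b \<le> u x} = 0"
      by (rule simple_tau_nbhd[OF \<zeta> cpt uC u(3) ut])
    then obtain c where "b < c" "c < 1" using dense by blast
    then show ?thesis using u(1-3) up b by (intro exI[of _ u] exI[of _ b] exI[of _ c]) auto
  qed
  then obtain u b c where u: "\<And>p. u p \<in> R" "\<And>p x. 0 \<le> u p x" "\<And>p x. u p x \<le> 1"
    and bc: "\<And>p. 0 < b p" "\<And>p. b p < c p" "\<And>p. c p < u p p" "\<And>p. tau \<zeta> {x. b p \<le> u p x} = 0"
    by metis
  have "open {x. c p < u p x}" for p
    using u(1)[of p] R(3) by (auto simp: C_functions_def intro!: open_Collect_less continuous_intros)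
  moreover have "UNIV \<subseteq> (\<Union>p\<in>UNIV. {x. c p < u p x})" using bc(3) by blast
  ultimately obtain I where I: "finite I" "UNIV \<subseteq> (\<Union>p\<in>I. {x. c p < u p x})"
    using compactE_image[OF cpt, of UNIV "\<lambda>p. {x. c p < u p x}"] by metis
  let ?e = "1 / (2 * (real (card I) + 1))"
  have "\<exists>f\<in>R. (\<forall>x. 0 \<le> f x) \<and> (\<forall>x. c p \<le> u p x \<longrightarrow> 1 \<le> f x) \<and> \<zeta> f \<le> ?e" for p
  proof -
    have "0 < ?e" by simp
    from sharpened_peak[OF \<zeta>(1) R(1,3) u(1)[of p] u(2)[of p] u(3)[of p] bc(1)[of p] bc(2)[of p] bc(4)[of p] this]
    show ?thesis by metis
  qed
  then obtain f where f: "\<And>p. f p \<in> R" "\<And>p x. 0 \<le> f p x"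
      "\<And>p x. c p \<le> u p x \<Longrightarrow> 1 \<le> f p x" "\<And>p. \<zeta> (f p) \<le> ?e"
    by metis
  have "1 = \<zeta> (\<lambda>_. 1)" by (simp add: quasi_state_const[OF \<zeta>(1)])
  also have "\<dots> \<le> \<zeta> (\<lambda>x. \<Sum>p\<in>I. f p x)"
  proof (rule quasi_state_mono[OF \<zeta>(1)])
    show "(\<lambda>x. \<Sum>p\<in>I. f p x) \<in> C_functions" 
      by (rule subsetD[OF R(3) function_algebra_sum[OF R(1) f(1)]])
    show "1 \<le> (\<Sum>p\<in>I. f p x)" for x
    proof -
      obtain p where "p \<in> I" "c p < u p x" using I(2) by blast
      then have "1 \<le> f p x" by (intro f(3)) simp
      also have "\<dots> \<le> (\<Sum>p\<in>I. f p x)"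
        using \<open>p \<in> I\<close> f(2) I(1) by (intro member_le_sum) auto
      finally show ?thesis .
    qed
  qed (simp add: C_functions_def)
  also have "\<dots> \<le> (\<Sum>p\<in>I. \<zeta> (f p))"
    by (rule quasi_state_sum_le[OF \<zeta>(1) R(1,2,4) I(1) f(1)])
  also have "\<dots> \<le> real (card I) * ?e" using f(4) by (intro sum_bounded_above)
  also have "\<dots> < 1" by (simp add: field_simps)
  finally show False by simp
qed

theorem corollary1p9:
  fixes \<A> :: "('a::t2_space, 'b::real_normed_vector) chart set"
    and \<omega> :: "'a \<Rightarrow> 'a tvec \<Rightarrow> 'a tvec \<Rightarrow> real"
    and AA :: "('a \<Rightarrow> real) set"
    and \<zeta> :: "('a \<Rightarrow> real) \<Rightarrow> real"
  assumes "closed_symplectic_manifold \<A> \<omega>"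
    and "poisson_commutative_subspace \<A> \<omega> AA"
    and "finite_dim_space AA"
    and "partial_symplectic_quasi_state \<A> \<omega> \<zeta>"
    and "simple \<zeta>"
  shows "\<exists>y\<^sub>0 \<in> range (moment_map AA). heavy \<zeta> (moment_map AA -` {y\<^sub>0})"
proof -
  have cpt: "compact (UNIV :: 'a set)"
    using assms(1) by (simp add: closed_symplectic_manifold_def closed_manifold_def)
  obtain R where R: "AA \<subseteq> R" "R \<subseteq> C_infinity \<A>" "function_algebra R"
    "\<And>F G p. F \<in> R \<Longrightarrow> G \<in> R \<Longrightarrow> poisson_bracket \<A> \<omega> F G p = 0"
    by (rule poisson_commutative_in_commutative_algebra[OF assms(1), of AA])
      (use assms(2) in \<open>auto simp: poisson_commutative_subspace_def\<close>)
  have RC: "R \<subseteq> C_functions"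
    using C_infinity_continuous[OF symplectic_atlas[OF assms(1)]] R(2) by (auto simp: C_functions_def)
  obtain B where B: "finite B" "fun_space.span B = AA"
    using assms(3) by (auto simp: finite_dim_space_def)
  have BA: "B \<subseteq> AA" using fun_space.span_superset[of B] B(2) by simp
  then have BR: "B \<subseteq> R" using R(1) by simp
  obtain p where p: "tau \<zeta> {x. \<forall>F\<in>B. F x = F p} \<noteq> 0"
    using exists_fibre_tau_nonzero[OF assms(4,5) cpt R(3,2) RC R(4) B(1) BR] by auto
  \<comment> \<open>A spanning set of \<open>AA\<close> separates the same points as \<open>AA\<close>, so it has the same fibres.\<close>
  have span: "AA \<subseteq> {F. F x = F p}" if "\<forall>F\<in>B. F x = F p" for x
    unfolding B(2)[symmetric] using that
    by (intro fun_space.span_minimal) (auto simp: fun_space.subspace_def)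
  have fibre: "moment_map AA -` {moment_map AA p} = {x. \<forall>F\<in>B. F x = F p}"
  proof -
    have "moment_map AA x = moment_map AA p \<longleftrightarrow> (\<forall>F\<in>AA. F x = F p)" for x
      by (auto simp: moment_map_def fun_eq_iff restrict_def)
    moreover have "(\<forall>F\<in>AA. F x = F p) \<longleftrightarrow> (\<forall>F\<in>B. F x = F p)" for x
      using BA span[of x] by blast
    ultimately show ?thesis by auto
  qed
  have cl: "closed {x. \<forall>F\<in>B. F x = F p}"
    using BR RC
    by (auto simp: C_functions_def Collect_ball_eq intro!: closed_INT closed_Collect_eq continuous_on_const)
  have "tau \<zeta> {x. \<forall>F\<in>B. F x = F p} = 1" using assms(5) cl p by (auto simp: simple_def)
  then have "heavy \<zeta> {x. \<forall>F\<in>B. F x = F p}"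
    by (intro heavy_if_tau_1[OF assms(4) cpt cl]) auto
  then show ?thesis unfolding fibre[symmetric] by blast
qed

end
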